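(* Let $b\ge 1$ be an integer. For each integer $n\ge 1$, $$\overline{S}_b(n)\equiv 0 \pmod{2b}.$$
   Context: An overpartition of a nonnegative integer $n$ is a partition of $n$ in which the first occurrence of each distinct part may be overlined (or not). $\overline{S}_b(n)$ denotes the sum of all parts equal to $b$ (overlined or not, counted with multiplicity) appearing in all overpartitions of $n$. *)

theory Defs
  imports "HOL-Library.Multiset" "HOL-Number_Theory.Cong"
begin

definition is_partition :: "nat \<Rightarrow> nat multiset \<Rightarrow> bool" where
  "is_partition n P \<longleftrightarrow> 0 \<notin># P \<and> sum_mset P = n"

text \<open>An overpartition is a pair \<open>(P, U)\<close>: \<open>P\<close> is the multiset of all parts, overlined or not, and
  \<open>U\<close> is the set of those distinct parts whose first occurrence is overlined.\<close>

definition overpartitions :: "nat \<Rightarrow> (nat multiset \<times> nat set) set" where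
  "overpartitions n = {(P, U). is_partition n P \<and> U \<subseteq> set_mset P}"

definition overpartition_part_sum :: "nat \<Rightarrow> nat \<Rightarrow> nat" where
  "overpartition_part_sum b n =
     (\<Sum>(P, U)\<in>overpartitions n. \<Sum>p\<in>#filter_mset (\<lambda>p. p = b) P. p)"

text \<open>The outer sum ranges over a finite set, so it is not subject to the convention that sums over
  infinite sets are zero.\<close>

lemma is_partition_bounds:
  assumes "is_partition n P"
  shows "size P \<le> n" and "set_mset P \<subseteq> {1..n}"
proof -
  have "0 \<notin># P \<Longrightarrow> size P \<le> sum_mset P" by (induction P) auto
  with assms show "size P \<le> n" by (auto simp: is_partition_def)
  have "p \<le> sum_mset P" if "p \<in># P" for p
    using that by (metis insert_DiffM le_add1 sum_mset.add_mset)
  with assms show "set_mset P \<subseteq> {1..n}"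
    by (auto simp: is_partition_def Suc_le_eq intro: gr0I)
qed

lemma finite_overpartitions: "finite (overpartitions n)"
proof -
  let ?M = "mset ` {xs. set xs \<subseteq> {1..n} \<and> length xs \<le> n}"
  have "overpartitions n \<subseteq> ?M \<times> Pow {1..n}"
  proof (rule subsetI)
    fix x assume "x \<in> overpartitions n"
    then obtain P U where x: "x = (P, U)" and P: "is_partition n P" and U: "U \<subseteq> set_mset P"
      by (auto simp: overpartitions_def)
    obtain xs where xs: "mset xs = P" using ex_mset by blast
    have "set xs \<subseteq> {1..n} \<and> length xs \<le> n"
      using is_partition_bounds[OF P] xs by (metis set_mset_mset size_mset)
    hence "P \<in> ?M" using xs by blast
    moreover have "U \<in> Pow {1..n}" using U is_partition_bounds(2)[OF P] by blast
    ultimately show "x \<in> ?M \<times> Pow {1..n}" using x by blast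
  qed
  moreover have "finite (?M \<times> Pow {1..n})"
    by (intro finite_cartesian_product finite_imageI finite_lists_length_le) auto
  ultimately show ?thesis by (rule finite_subset)
qed

end

theory Submission
  imports Defs
begin

text \<open>
  The overpartitions that contain the part \<open>b\<close> come in pairs: the two members of a pair agree
  except that the first occurrence of \<open>b\<close> is overlined in one and plain in the other. Both members
  contain \<open>b\<close> equally often, and overpartitions without \<open>b\<close> contribute nothing, so the total
  number of occurrences of \<open>b\<close> is even, namely twice the number of occurrences in overpartitions
  whose first \<open>b\<close> is overlined. Each occurrence adds \<open>b\<close> to the sum of parts, which yields
  the factor \<open>2 * b\<close>.
\<close>

lemma sum_mset_filter_eq: "sum_mset (filter_mset (\<lambda>p. p = b) P) = b * count P b" for b :: nat
  by (induction P) auto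

lemma bij_betw_remove_overline:
  "bij_betw (\<lambda>(P, U). (P, U - {b}))
     {(P, U) \<in> overpartitions n. b \<in> U}
     {(P, U) \<in> overpartitions n. b \<in># P \<and> b \<notin> U}"
  by (rule bij_betw_byWitness[where f' = "\<lambda>(P, U). (P, insert b U)"])
     (auto simp: overpartitions_def)

text \<open>The right-hand side singles out one member of each pair, so it exhibits the factor
  \<open>2 * b\<close> as an equation and not only as a divisibility.\<close>

lemma overpartition_part_sum_eq_twice_overlined:
  "overpartition_part_sum b n =
     2 * b * (\<Sum>(P, U) \<in> {(P, U) \<in> overpartitions n. b \<in> U}. count P b)"
proof -
  define overlined where "overlined = {(P, U) \<in> overpartitions n. b \<in> U}"
  define plain where "plain = {(P, U) \<in> overpartitions n. b \<in># P \<and> b \<notin> U}"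
  have sub: "overlined \<union> plain \<subseteq> overpartitions n"
    by (auto simp: overlined_def plain_def)
  have fin: "finite overlined" "finite plain"
    using finite_subset[OF sub finite_overpartitions] by auto
  have disj: "overlined \<inter> plain = {}"
    by (auto simp: overlined_def plain_def)
  have "(\<Sum>(P, U)\<in>overpartitions n. count P b) = (\<Sum>(P, U)\<in>overlined \<union> plain. count P b)"
    by (rule sum.mono_neutral_right[OF finite_overpartitions sub])
       (auto simp: overlined_def plain_def not_in_iff)
  also have "\<dots> = (\<Sum>(P, U)\<in>overlined. count P b) + (\<Sum>(P, U)\<in>plain. count P b)"
    by (rule sum.union_disjoint[OF fin disj])
  also have "(\<Sum>(P, U)\<in>plain. count P b) = (\<Sum>(P, U)\<in>overlined. count P b)"
    using sum.reindex_bij_betw[OF bij_betw_remove_overline[of b n], of "\<lambda>(P, U). count P b"]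
    by (simp add: overlined_def plain_def case_prod_unfold)
  finally have "(\<Sum>(P, U)\<in>overpartitions n. count P b) = 2 * (\<Sum>(P, U)\<in>overlined. count P b)"
    by simp
  moreover have "overpartition_part_sum b n = b * (\<Sum>(P, U)\<in>overpartitions n. count P b)"
    by (simp add: overpartition_part_sum_def sum_mset_filter_eq sum_distrib_left case_prod_unfold)
  ultimately show ?thesis
    by (simp add: overlined_def)
qed

theorem corollary7:
  fixes b n :: nat
  assumes "b \<ge> 1" and "n \<ge> 1"
  shows "[overpartition_part_sum b n = 0] (mod (2 * b))"
  unfolding cong_0_iff overpartition_part_sum_eq_twice_overlined by (rule dvd_triv_left)

end
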